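(* Let $G$ be a connected chordal graph with maximal cliques $C_1,\dots,C_K$, and let $C$ be a maximal clique of $G$. Then $C$ is simply separated if and only if there exists a perfect sequence $C_{\pi(1)},\dots,C_{\pi(K)}$ of the maximal cliques of $G$ such that $C_{\pi(K)}=C$.
   Context: Graphs are finite, simple and undirected. Maximal cliques are regarded as subsets of the vertex set $V$; $\mathcal C=\{C_1,\dots,C_K\}$ is the set of all maximal cliques of $G$, $K=|\mathcal C|$. The symbol $\subset$ denotes proper containment. A vertex $v$ is simplicial if its set of neighbors is a clique. For $C\in\mathcal C$, $\mathrm{Simp}(C)$ is the set of simplicial vertices of $G$ lying in $C$ and $\mathrm{Sep}(C)=C\setminus\mathrm{Simp}(C)$. A maximal clique $C$ with $\mathrm{Simp}(C)\ne\emptyset$ is called simply separated (or a boundary clique) if there exists a maximal clique $C'\in\mathcal C$ with $\mathrm{Sep}(C)=C\cap C'$. For a permutation $\pi$ of $\{1,\dots,K\}$ put $S_{\pi(k)}=(C_{\pi(1)}\cup\cdots\cup C_{\pi(k-1)})\cap C_{\pi(k)}$ for $k=2,\dots,K$. The sequence $C_{\pi(1)},\dots,C_{\pi(K)}$ is a perfect sequence of the maximal cliques if for all $k\ge2$ the set $S_{\pi(k)}$ is a clique and there exists $k'<k$ with $S_{\pi(k)}\subset C_{\pi(k')}$ (running intersection property).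
   Formalization: The formal theorem assumes K ≥ 2 (G is not complete); for K = 1 the claim fails, since Sep(C) is empty while C ∩ C' = C is not, so C is not simply separated although the one-term sequence is vacuously perfect and ends in C. *)

theory Defs
  imports "Graph_Theory.Graph_Theory" "HOL-Combinatorics.Permutations"
begin

text \<open>
  A finite simple undirected graph is a symmetric digraph without loops and multiple arcs
  (locale \<^locale>\<open>graph\<close>): an edge \<open>uv\<close> is the pair of arcs from \<open>u\<close> to \<open>v\<close> and from \<open>v\<close> to \<open>u\<close>.
\<close>

definition neighbors :: "('a,'b) pre_digraph \<Rightarrow> 'a \<Rightarrow> 'a set" where
  "neighbors G v = {u \<in> verts G. v \<rightarrow>\<^bsub>G\<^esub> u}"

definition clique :: "('a,'b) pre_digraph \<Rightarrow> 'a set \<Rightarrow> bool" where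
  "clique G A \<longleftrightarrow> A \<subseteq> verts G \<and> (\<forall>u\<in>A. \<forall>v\<in>A. u \<noteq> v \<longrightarrow> u \<rightarrow>\<^bsub>G\<^esub> v)"

definition maximal_cliques :: "('a,'b) pre_digraph \<Rightarrow> 'a set set" where
  "maximal_cliques G = {C. clique G C \<and> \<not> (\<exists>D. clique G D \<and> C \<subset> D)}"

text \<open>
  Cycles are arc lists. A chord joins two vertices of the cycle and is not an edge of the cycle
  in either direction. The library counts \<open>u, v, u\<close> as a cycle of a symmetric digraph; the length
  bound excludes it.
\<close>

definition is_chord :: "('a,'b) pre_digraph \<Rightarrow> 'b list \<Rightarrow> 'b \<Rightarrow> bool" where
  "is_chord G p a \<longleftrightarrow> a \<in> arcs G
     \<and> tail G a \<in> tail G ` set p \<and> head G a \<in> tail G ` set p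
     \<and> (\<forall>e\<in>set p. {tail G e, head G e} \<noteq> {tail G a, head G a})"

definition chordal :: "('a,'b) pre_digraph \<Rightarrow> bool" where
  "chordal G \<longleftrightarrow> (\<forall>p. pre_digraph.cycle G p \<and> 4 \<le> length p \<longrightarrow> (\<exists>a. is_chord G p a))"

definition simplicial :: "('a,'b) pre_digraph \<Rightarrow> 'a \<Rightarrow> bool" where
  "simplicial G v \<longleftrightarrow> v \<in> verts G \<and> clique G (neighbors G v)"

definition Simp :: "('a,'b) pre_digraph \<Rightarrow> 'a set \<Rightarrow> 'a set" where
  "Simp G C = {v \<in> C. simplicial G v}"

definition Sep :: "('a,'b) pre_digraph \<Rightarrow> 'a set \<Rightarrow> 'a set" where
  "Sep G C = C - Simp G C"

text \<open>
  \<open>C' = C\<close> need not be excluded: it would force \<open>Simp G C = {}\<close>. Consequently the unique maximal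
  clique of a complete graph is not simply separated.
\<close>

definition simply_separated :: "('a,'b) pre_digraph \<Rightarrow> 'a set \<Rightarrow> bool" where
  "simply_separated G C \<longleftrightarrow> C \<in> maximal_cliques G \<and> Simp G C \<noteq> {}
     \<and> (\<exists>C'\<in>maximal_cliques G. Sep G C = C \<inter> C')"

text \<open>
  Below, \<open>Cs 1, \<dots>, Cs K\<close> enumerates the maximal cliques and \<open>p\<close> is a permutation of \<open>{1..K}\<close>.
\<close>

definition perfect_sep :: "(nat \<Rightarrow> 'a set) \<Rightarrow> (nat \<Rightarrow> nat) \<Rightarrow> nat \<Rightarrow> 'a set" where
  "perfect_sep Cs p k = (\<Union>i\<in>{1..<k}. Cs (p i)) \<inter> Cs (p k)"

definition perfect_sequence ::
    "('a,'b) pre_digraph \<Rightarrow> nat \<Rightarrow> (nat \<Rightarrow> 'a set) \<Rightarrow> (nat \<Rightarrow> nat) \<Rightarrow> bool" where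
  "perfect_sequence G K Cs p \<longleftrightarrow> p permutes {1..K}
     \<and> (\<forall>k\<in>{2..K}. clique G (perfect_sep Cs p k)
          \<and> (\<exists>k'\<in>{1..<k}. perfect_sep Cs p k \<subset> Cs (p k')))"

end

theory Submission
  imports Defs
begin

text \<open>
  If a perfect sequence ends in \<open>C\<close>, the vertices of \<open>C\<close> outside the earlier cliques lie in no other
  maximal clique and are therefore simplicial, while those of \<open>S = C \<inter> C'\<close> lie in two maximal cliques
  and are not; hence \<open>Sep C = C \<inter> C'\<close>. Conversely, deleting \<open>Simp C\<close> from \<open>G\<close> leaves a chordal graph
  whose maximal cliques are those of \<open>G\<close> other than \<open>C\<close>, so \<open>C\<close> can be appended to any perfect
  sequence of that graph.

  Perfect sequences exist by induction on the number of vertices: delete a simplicial vertex \<open>v\<close>; its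
  neighbourhood either is a maximal clique of the rest, and then absorbs \<open>v\<close> within the sequence, or it
  is properly contained in one, and then the closed neighbourhood of \<open>v\<close> is appended.

  For a simplicial vertex of a chordal graph that is not complete, take a maximal connected set \<open>A\<close>
  whose closed neighbourhood is not everything, and let \<open>B \<noteq> {}\<close> be the rest. By maximality \<open>N(A)\<close>
  is completely joined to \<open>B\<close>; by chordality it is a clique (two nonadjacent vertices of \<open>N(A)\<close>, a
  shortest path between them through \<open>A\<close> and a vertex of \<open>B\<close> would form a chordless cycle). So a
  simplicial vertex of the subgraph induced on \<open>B\<close> is simplicial in the whole graph.
\<close>

section \<open>Chordless cycles and simplicial vertices\<close>

text \<open>A vertex sequence over a bare relation instead of an arc list; the exempted pair
  \<open>0\<close>, \<open>m - 1\<close> is the closing edge.\<close>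

definition chordless_cycle :: "('a \<Rightarrow> 'a \<Rightarrow> bool) \<Rightarrow> (nat \<Rightarrow> 'a) \<Rightarrow> nat \<Rightarrow> bool" where
  "chordless_cycle E c m \<longleftrightarrow> c m = c 0 \<and> inj_on c {..<m} \<and> (\<forall>i<m. E (c i) (c (Suc i)))
     \<and> (\<forall>i j. i < j \<and> j < m \<and> E (c i) (c j) \<longrightarrow> j = Suc i \<or> i = 0 \<and> Suc j = m)"

text \<open>Only inner vertices must lie in \<open>A\<close>, so two vertices outside
  \<open>A\<close> can be joined through it.\<close>

definition walk_through :: "('a \<Rightarrow> 'a \<Rightarrow> bool) \<Rightarrow> 'a set \<Rightarrow> 'a \<Rightarrow> 'a \<Rightarrow> nat \<Rightarrow> (nat \<Rightarrow> 'a) \<Rightarrow> bool" where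
  "walk_through E A x y n p \<longleftrightarrow> p 0 = x \<and> p n = y \<and> (\<forall>i<n. E (p i) (p (Suc i)))
     \<and> (\<forall>i. 0 < i \<and> i < n \<longrightarrow> p i \<in> A)"

definition connected_within :: "('a \<Rightarrow> 'a \<Rightarrow> bool) \<Rightarrow> 'a set \<Rightarrow> bool" where
  "connected_within E A \<longleftrightarrow> (\<forall>x\<in>A. \<forall>y\<in>A. \<exists>n p. walk_through E A x y n p)"

section \<open>Walks and shortest walks through a set\<close>

lemma walk_through_mono: "walk_through E A x y n p \<Longrightarrow> A \<subseteq> B \<Longrightarrow> walk_through E B x y n p"
  by (auto simp: walk_through_def)

lemma walk_through_Cons:
  assumes "walk_through E A y z n p" "E x y" "y \<in> A"
  shows "walk_through E A x z (Suc n) (case_nat x p)"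
  unfolding walk_through_def
proof (intro conjI allI impI)
  show "E (case_nat x p i) (case_nat x p (Suc i))" if "i < Suc n" for i
    using that assms by (cases i) (auto simp: walk_through_def)
  show "case_nat x p i \<in> A" if "0 < i \<and> i < Suc n" for i
    using that assms by (cases i; cases "i - 1") (auto simp: walk_through_def)
qed (use assms in \<open>auto simp: walk_through_def\<close>)

lemma walk_through_sym:
  assumes "symp E" "walk_through E A x y n p"
  shows "walk_through E A y x n (\<lambda>i. p (n - i))"
  unfolding walk_through_def
proof (intro conjI allI impI)
  fix i assume i: "i < n"
  then have "E (p (n - Suc i)) (p (Suc (n - Suc i)))"
    using assms(2) by (simp add: walk_through_def)
  then show "E (p (n - i)) (p (n - Suc i))"
    using i assms(1) by (simp add: Suc_diff_Suc symp_def)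
qed (use assms(2) in \<open>auto simp: walk_through_def\<close>)

text \<open>Common splice for chords and repetitions: the \<open>d\<close> positions after
  \<open>i\<close> are dropped. If \<open>i = n\<close>, no step follows the gap, so the endpoints
  must agree instead.\<close>

lemma walk_through_skip:
  assumes w: "walk_through E A x y (n + d) p" and i: "i \<le> n"
    and lt: "i < n \<Longrightarrow> E (p i) (p (Suc i + d))" and eq: "i = n \<Longrightarrow> p i = p (n + d)"
  shows "walk_through E A x y n (\<lambda>k. if k \<le> i then p k else p (k + d))"
  unfolding walk_through_def
proof (intro conjI allI impI)
  have p: "p 0 = x" "p (n + d) = y" "\<And>k. k < n + d \<Longrightarrow> E (p k) (p (Suc k))"
    "\<And>k. 0 < k \<Longrightarrow> k < n + d \<Longrightarrow> p k \<in> A"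
    using w by (auto simp: walk_through_def)
  show "(if 0 \<le> i then p 0 else p (0 + d)) = x" using p(1) by simp
  show "(if n \<le> i then p n else p (n + d)) = y" using p(2) i eq by (cases "i = n") auto
  fix k
  show "E (if k \<le> i then p k else p (k + d)) (if Suc k \<le> i then p (Suc k) else p (Suc k + d))"
    if "k < n"
  proof -
    consider "k < i" | "k = i" | "i < k" by linarith
    then show ?thesis by cases (use p(3)[of k] p(3)[of "k + d"] lt that in auto)
  qed
  show "(if k \<le> i then p k else p (k + d)) \<in> A" if "0 < k \<and> k < n"
    using p(4)[of k] p(4)[of "k + d"] that by auto
qed

lemma walk_through_shortcut:
  assumes w: "walk_through E A x y n p" and ij: "Suc i < j" "j \<le> n" "E (p i) (p j)"
  shows "\<exists>m<n. \<exists>q. walk_through E A x y m q"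
proof -
  define d m where "d = j - Suc i" and "m = n - d"
  have "n = m + d" "j = Suc i + d" "i < m" "m < n" using ij by (auto simp: d_def m_def)
  then have "\<exists>q. walk_through E A x y m q"
    using walk_through_skip[of E A x y m d p i] w ij(3) by auto
  then show ?thesis using \<open>m < n\<close> by blast
qed

lemma walk_through_cut:
  assumes w: "walk_through E A x y n p" and ij: "i < j" "j \<le> n" "p i = p j"
  shows "\<exists>m<n. \<exists>q. walk_through E A x y m q"
proof -
  define d m where "d = j - i" and "m = n - d"
  have d: "n = m + d" "j = i + d" "i \<le> m" "m < n" using ij by (auto simp: d_def m_def)
  have "E (p i) (p (Suc i + d))" if "i < m"
    using w ij(3) that d by (auto simp: walk_through_def)
  then have "\<exists>q. walk_through E A x y m q"
    using walk_through_skip[of E A x y m d p i] w ij(3) d by auto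
  then show ?thesis using \<open>m < n\<close> by blast
qed

text \<open>In a walk of least length, a repeated vertex or an edge that skips positions would allow
  a shorter one.\<close>

lemma shortest_walk_through:
  assumes "walk_through E A x y n p"
  obtains m q where "walk_through E A x y m q" "inj_on q {..m}"
    "\<And>i j. i < j \<Longrightarrow> j \<le> m \<Longrightarrow> E (q i) (q j) \<Longrightarrow> j = Suc i"
proof -
  define m where "m = (LEAST m. \<exists>q. walk_through E A x y m q)"
  have "\<exists>q. walk_through E A x y m q"
    unfolding m_def by (rule LeastI_ex) (use assms in blast)
  then obtain q where q: "walk_through E A x y m q" by blast
  have le: "m \<le> k" if "\<exists>r. walk_through E A x y k r" for k
    unfolding m_def using that by (rule Least_le)
  have "q i \<noteq> q j" if "i < j" "j \<le> m" for i j
    using walk_through_cut[OF q that] le by (meson not_less)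
  then have "inj_on q {..m}" by (metis atMost_iff inj_onI linorder_neqE_nat)
  moreover have "j = Suc i" if "i < j" "j \<le> m" "E (q i) (q j)" for i j
  proof (rule ccontr)
    assume "j \<noteq> Suc i"
    then have "Suc i < j" using that by simp
    then show False using walk_through_shortcut[OF q _ that(2,3)] le by (meson not_less)
  qed
  ultimately show ?thesis using that q by blast
qed

lemma connected_within_insert:
  assumes sym: "symp E" and A: "connected_within E A" and x: "a \<in> A" "E x a"
  shows "connected_within E (insert x A)"
proof -
  have xy: "\<exists>n p. walk_through E (insert x A) x y n p" if y: "y \<in> A" for y
  proof -
    obtain n p where "walk_through E A a y n p" using A x y unfolding connected_within_def by meson
    then have "walk_through E (insert x A) a y n p" by (rule walk_through_mono) blast
    then show ?thesis using walk_through_Cons x by (metis insertCI)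
  qed
  have xx: "walk_through E (insert x A) x x 0 (\<lambda>_. x)" by (simp add: walk_through_def)
  have AA: "\<exists>n p. walk_through E (insert x A) y z n p" if "y \<in> A" "z \<in> A" for y z
    using A that walk_through_mono[of E A _ _ _ _ "insert x A"] unfolding connected_within_def
    by (meson subset_insertI)
  show ?thesis
    unfolding connected_within_def using xx xy AA walk_through_sym[OF sym] by (metis insert_iff)
qed

text \<open>A shortest walk from \<open>x\<close> to \<open>y\<close> through \<open>A\<close> has
  no chord, and \<open>b\<close> sees only its two ends, so \<open>b\<close> closes it to a
  chordless cycle. The walk has at least two steps because \<open>x\<close> and \<open>y\<close> are
  distinct and nonadjacent.\<close>

lemma nonadjacent_attachments_chordless_cycle:
  assumes sym: "symp E"
    and A: "connected_within E A"
    and x: "x \<notin> A" "a \<in> A" "E x a" and y: "y \<notin> A" "a' \<in> A" "E y a'"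
    and xy: "x \<noteq> y" "\<not> E x y"
    and b: "b \<notin> A" "\<forall>a\<in>A. \<not> E a b" "E x b" "E y b" "b \<noteq> x" "b \<noteq> y"
  shows "\<exists>c m. 4 \<le> m \<and> chordless_cycle E c m"
proof -
  have s: "\<And>u v. E u v \<Longrightarrow> E v u" using sym by (rule sympD)
  \<comment> \<open>The walk x, a, ..., a', y is built from its far end: prepend \<open>y\<close>,
    reverse, prepend \<open>x\<close>.\<close>
  obtain n0 p0 where "walk_through E A a' a n0 p0" using A x y unfolding connected_within_def by blast
  then have "walk_through E A y a (Suc n0) (case_nat y p0)" using y by (intro walk_through_Cons)
  then have "\<exists>p. walk_through E A a y (Suc n0) p" using walk_through_sym[OF sym] by blast
  then obtain n1 p1 where "walk_through E A x y n1 p1" using walk_through_Cons x by metis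
  then obtain m q where w: "walk_through E A x y m q" and inj: "inj_on q {..m}"
    and ch: "\<And>i j. i < j \<Longrightarrow> j \<le> m \<Longrightarrow> E (q i) (q j) \<Longrightarrow> j = Suc i"
    by (rule shortest_walk_through) blast
  have q: "q 0 = x" "q m = y" "\<And>i. i < m \<Longrightarrow> E (q i) (q (Suc i))"
    "\<And>i. 0 < i \<Longrightarrow> i < m \<Longrightarrow> q i \<in> A"
    using w by (auto simp: walk_through_def)
  have "m \<noteq> 0" using q xy by metis
  moreover have "m \<noteq> 1" using q(3)[of 0] q xy by auto
  ultimately have m: "2 \<le> m" by simp
  have nb: "q i \<noteq> b" if "i \<le> m" for i
    using q(1,2) q(4)[of i] b that by (metis le_neq_implies_less neq0_conv)
  have eb: "i = 0 \<or> i = m" if "i \<le> m" "E (q i) b" for i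
    using q(4)[of i] b that by (metis le_neq_implies_less neq0_conv)
  define c where "c i = (if i \<le> m then q i else if i = Suc m then b else x)" for i
  have "chordless_cycle E c (m + 2)"
    unfolding chordless_cycle_def
  proof (intro conjI allI impI)
    show "c (m + 2) = c 0" by (simp add: c_def q)
    show "inj_on c {..<m + 2}"
      using inj nb unfolding inj_on_def c_def by (auto simp: less_Suc_eq_le le_Suc_eq)
    show "E (c i) (c (Suc i))" if i: "i < m + 2" for i
    proof -
      consider "i < m" | "i = m" | "i = Suc m" using i by linarith
      then show ?thesis by cases (use q b s in \<open>auto simp: c_def\<close>)
    qed
    fix i j assume H: "i < j \<and> j < m + 2 \<and> E (c i) (c j)"
    show "j = Suc i \<or> i = 0 \<and> Suc j = m + 2"
    proof (cases "j \<le> m")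
      case True
      then show ?thesis using H ch[of i j] by (auto simp: c_def)
    next
      case False
      then have "j = Suc m" using H by simp
      then show ?thesis using H eb[of i] by (auto simp: c_def)
    qed
  qed
  then show ?thesis using m by (intro exI[of _ c] exI[of _ "m + 2"]) simp
qed

text \<open>The absence of chordless cycles is assumed of \<open>E\<close> alone, so it passes
  unchanged to the smaller set \<open>B\<close> in the induction.\<close>

lemma ex_simplicial_vertex:
  assumes sym: "symp E" and chordal: "\<And>c m. 4 \<le> m \<Longrightarrow> \<not> chordless_cycle E c m"
    and "finite V" "V \<noteq> {}"
  shows "\<exists>v\<in>V. \<forall>x\<in>V. \<forall>y\<in>V. E v x \<longrightarrow> E v y \<longrightarrow> x \<noteq> y \<longrightarrow> x \<noteq> v \<longrightarrow> y \<noteq> v \<longrightarrow> E x y"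
  using \<open>finite V\<close> \<open>V \<noteq> {}\<close>
proof (induction V rule: finite_psubset_induct)
  case (psubset V)
  have s: "\<And>u v. E u v \<Longrightarrow> E v u" using sym by (rule sympD)
  show ?case
  proof (cases "\<forall>u\<in>V. \<forall>v\<in>V. u \<noteq> v \<longrightarrow> E u v")
    case True
    then show ?thesis using psubset.prems by blast
  next
    case False
    then obtain u w where uw: "u \<in> V" "w \<in> V" "u \<noteq> w" "\<not> E u w" by blast
    \<comment> \<open>\<open>rest A\<close> is what lies outside the closed neighbourhood of
      \<open>A\<close> in \<open>V\<close>; \<open>P {u}\<close> holds because \<open>w\<close> is
      in \<open>rest {u}\<close>.\<close>
    define rest where "rest A = {b \<in> V - A. \<forall>a\<in>A. \<not> E a b}" for A
    define P where "P A \<longleftrightarrow> A \<subseteq> V \<and> A \<noteq> {} \<and> connected_within E A \<and> rest A \<noteq> {}" for A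
    have "connected_within E {u}"
      by (auto simp: connected_within_def walk_through_def intro!: exI[of _ 0] exI[of _ "\<lambda>_. u"])
    then have "P {u}" using uw by (auto simp: P_def rest_def)
    moreover have "finite (Collect P)"
      by (rule finite_subset[of _ "Pow V"]) (auto simp: P_def psubset.hyps)
    ultimately obtain A where A: "P A" and max: "\<And>A'. P A' \<Longrightarrow> A \<subseteq> A' \<Longrightarrow> A' = A"
      using finite_has_maximal[of "Collect P"] by (metis empty_iff mem_Collect_eq)
    define B where "B = rest A"
    have B: "B \<subset> V" "B \<noteq> {}" using A by (auto simp: B_def P_def rest_def)
    have BA: "b \<notin> A" "\<forall>a\<in>A. \<not> E a b" if "b \<in> B" for b using that by (auto simp: B_def rest_def)
    have N: "x \<notin> A \<and> (\<exists>a\<in>A. E x a)" if "x \<in> V" "x \<notin> B" "E b x" "b \<in> B" for x b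
      using that BA[OF \<open>b \<in> B\<close>] s by (auto simp: B_def rest_def)
    \<comment> \<open>Otherwise \<open>insert x A\<close> would still be connected and leave
      \<open>b\<close> in its rest, against maximality of \<open>A\<close>.\<close>
    have full: "E x b" if x: "x \<in> V" "x \<notin> A" "a \<in> A" "E x a" and b: "b \<in> B" for x a b
    proof (rule ccontr)
      assume "\<not> E x b"
      moreover have "b \<noteq> x" using x BA[OF b] s by blast
      ultimately have "b \<in> rest (insert x A)" using b by (auto simp: B_def rest_def)
      moreover have "connected_within E (insert x A)"
        using A x by (intro connected_within_insert[OF sym]) (auto simp: P_def)
      ultimately have "P (insert x A)" using A x by (auto simp: P_def)
      then show False using max[of "insert x A"] x by blast
    qed
    obtain v where v: "v \<in> B"
      "\<And>x y. x \<in> B \<Longrightarrow> y \<in> B \<Longrightarrow> E v x \<Longrightarrow> E v y \<Longrightarrow> x \<noteq> y \<Longrightarrow> x \<noteq> v \<Longrightarrow> y \<noteq> v \<Longrightarrow> E x y"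
      using psubset.IH[OF B] by blast
    \<comment> \<open>Two neighbours in \<open>B\<close> are settled by induction, a mixed pair by
      \<open>full\<close>, and two outside \<open>B\<close> by the chordless cycle through
      \<open>A\<close> and \<open>v\<close>.\<close>
    have "E x y" if xy: "x \<in> V" "y \<in> V" "E v x" "E v y" "x \<noteq> y" "x \<noteq> v" "y \<noteq> v" for x y
    proof (cases "x \<in> B"; cases "y \<in> B")
      assume "x \<notin> B" "y \<notin> B"
      then obtain a a' where "x \<notin> A" "a \<in> A" "E x a" "y \<notin> A" "a' \<in> A" "E y a'"
        using N[of x v] N[of y v] xy v(1) by blast
      then show ?thesis
        using nonadjacent_attachments_chordless_cycle[OF sym, of A x a y a' v] chordal
          A BA[OF v(1)] xy s unfolding P_def by blast
    qed (use xy v full N s in \<open>meson+\<close>)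
    then show ?thesis using v(1) B by blast
  qed
qed

section \<open>The running intersection property\<close>

text \<open>The vertex set is a parameter, so deleting vertices changes \<open>V\<close> and leaves
  \<open>E\<close> fixed.\<close>

definition clique_in :: "('a \<Rightarrow> 'a \<Rightarrow> bool) \<Rightarrow> 'a set \<Rightarrow> 'a set \<Rightarrow> bool" where
  "clique_in E V A \<longleftrightarrow> A \<subseteq> V \<and> (\<forall>u\<in>A. \<forall>v\<in>A. u \<noteq> v \<longrightarrow> E u v)"

definition max_cliques_in :: "('a \<Rightarrow> 'a \<Rightarrow> bool) \<Rightarrow> 'a set \<Rightarrow> 'a set set" where
  "max_cliques_in E V = {C. clique_in E V C \<and> \<not> (\<exists>D. clique_in E V D \<and> C \<subset> D)}"

lemma clique_in_extend:
  assumes "finite V" "clique_in E V A"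
  obtains C where "C \<in> max_cliques_in E V" "A \<subseteq> C"
proof -
  have "finite (Collect (clique_in E V))"
    by (rule finite_subset[of _ "Pow V"]) (use assms in \<open>auto simp: clique_in_def\<close>)
  then obtain C where "clique_in E V C" "A \<subseteq> C" "\<And>D. clique_in E V D \<Longrightarrow> C \<subseteq> D \<Longrightarrow> C = D"
    using finite_has_maximal2[of "Collect (clique_in E V)" A] assms(2) by auto
  then have "C \<in> max_cliques_in E V" unfolding max_cliques_in_def by blast
  then show ?thesis using that \<open>A \<subseteq> C\<close> by blast
qed

lemma max_cliques_in_antichain:
  "C \<in> max_cliques_in E V \<Longrightarrow> D \<in> max_cliques_in E V \<Longrightarrow> C \<subseteq> D \<Longrightarrow> C = D"
  by (auto simp: max_cliques_in_def)

text \<open>Every clique through \<open>v\<close> lies in \<open>insert v N\<close>, so this is the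
  only maximal clique containing \<open>v\<close>; among the maximal cliques of the rest only
  \<open>N\<close> can lose maximality.\<close>

lemma max_cliques_in_remove_simplicial:
  assumes sym: "symp E" and v: "v \<in> V" and N: "N = {u \<in> V - {v}. E v u}"
    and simp: "clique_in E (V - {v}) N"
  shows "max_cliques_in E V = insert (insert v N) (max_cliques_in E (V - {v}) - {N})"
proof -
  have s: "\<And>x y. E x y \<Longrightarrow> E y x" using sym by (rule sympD)
  have cl: "clique_in E V (insert v N)"
  proof -
    have "\<forall>u\<in>N. E v u \<and> E u v" using N s by simp
    then show ?thesis using simp v unfolding clique_in_def by blast
  qed
  have sub: "D \<subseteq> insert v N" if "clique_in E V D" "v \<in> D" for D
    using that N by (auto simp: clique_in_def)
  have vN: "v \<notin> N" using N by simp
  have iff: "clique_in E (V - {v}) D \<longleftrightarrow> clique_in E V D \<and> v \<notin> D" for D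
    by (auto simp: clique_in_def)
  have del: "clique_in E (V - {v}) (D - {v})" if "clique_in E V D" for D
    using that by (auto simp: clique_in_def)
  show ?thesis
  proof (intro equalityI subsetI)
    fix X assume X: "X \<in> max_cliques_in E V"
    show "X \<in> insert (insert v N) (max_cliques_in E (V - {v}) - {N})"
    proof (cases "v \<in> X")
      case True
      then have "X = insert v N" using X sub[of X] cl by (auto simp: max_cliques_in_def)
      then show ?thesis by simp
    next
      case False
      then show ?thesis using X cl iff vN by (auto simp: max_cliques_in_def)
    qed
  next
    fix X assume X: "X \<in> insert (insert v N) (max_cliques_in E (V - {v}) - {N})"
    show "X \<in> max_cliques_in E V"
    proof (cases "X = insert v N")
      case True
      then show ?thesis using cl sub unfolding max_cliques_in_def by blast
    next
      case False
      then have X': "X \<noteq> N" "clique_in E (V - {v}) X" "\<And>D. clique_in E (V - {v}) D \<Longrightarrow> X \<subseteq> D \<Longrightarrow> D = X"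
        using X by (auto simp: max_cliques_in_def)
      \<comment> \<open>A larger clique can only add \<open>v\<close>; then \<open>X\<close> lies in
        \<open>N\<close>, and maximality of \<open>X\<close> forces \<open>X = N\<close>.\<close>
      have "\<not> X \<subset> D" if D: "clique_in E V D" for D
      proof
        assume "X \<subset> D"
        then have "D - {v} = X" using X' iff del[OF D] by blast
        with \<open>X \<subset> D\<close> have "v \<in> D" by blast
        then have "X \<subseteq> N" using sub[OF D] \<open>D - {v} = X\<close> by blast
        then show False using X' simp by blast
      qed
      then show ?thesis using X' iff by (auto simp: max_cliques_in_def)
    qed
  qed
qed

text \<open>The head of the list is the last clique of the perfect sequence.\<close>

fun rip :: "'a set list \<Rightarrow> bool" where
  "rip [] \<longleftrightarrow> True"
| "rip (C # Ds) \<longleftrightarrow> rip Ds \<and> (Ds = [] \<or> (\<exists>D\<in>set Ds. C \<inter> \<Union> (set Ds) \<subseteq> D))"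

text \<open>The new vertex \<open>v\<close> enters at most one entry, since the list is distinct, so
  the intersection of an entry with the union of its successors does not change.\<close>

lemma rip_enlarge:
  assumes "rip Ds" "distinct Ds" "v \<notin> \<Union> (set Ds)"
  shows "rip (map (\<lambda>X. if X = N then insert v N else X) Ds)"
  using assms
proof (induction Ds)
  case (Cons C Ds)
  define f where "f X = (if X = N then insert v N else X)" for X
  have "f C \<inter> \<Union> (f ` set Ds) = C \<inter> \<Union> (set Ds)"
    using Cons.prems by (fastforce simp: f_def split: if_splits)
  moreover have "X \<subseteq> f X" for X by (auto simp: f_def)
  ultimately have "Ds = [] \<or> (\<exists>D\<in>set Ds. f C \<inter> \<Union> (f ` set Ds) \<subseteq> f D)"
    using Cons.prems by (metis rip.simps(2) subset_trans)
  moreover have "rip (map f Ds)" using Cons unfolding f_def by simp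
  ultimately have "rip (map f (C # Ds))" by auto
  then show ?case unfolding f_def .
qed simp

text \<open>Turns the recursion into positions: \<open>drop (Suc j) Ds\<close> holds the cliques
  that precede \<open>Ds ! j\<close> in the perfect sequence.\<close>

lemma rip_nth:
  assumes "rip Ds" "Suc j < length Ds"
  shows "\<exists>l. j < l \<and> l < length Ds \<and> Ds ! j \<inter> \<Union> (set (drop (Suc j) Ds)) \<subseteq> Ds ! l"
  using assms
proof (induction Ds arbitrary: j)
  case (Cons C Ds)
  show ?case
  proof (cases j)
    case 0
    then obtain D where "D \<in> set Ds" "C \<inter> \<Union> (set Ds) \<subseteq> D" using Cons.prems by auto
    then show ?thesis using 0 by (metis Suc_less_eq drop0 drop_Suc_Cons in_set_conv_nth length_Cons
          nth_Cons_0 nth_Cons_Suc zero_less_Suc)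
  next
    case (Suc i)
    then obtain l where "i < l \<and> l < length Ds \<and> Ds ! i \<inter> \<Union> (set (drop (Suc i) Ds)) \<subseteq> Ds ! l"
      using Cons.IH[of i] Cons.prems by auto
    then show ?thesis using Suc by (intro exI[of _ "Suc l"]) auto
  qed
qed simp

lemma ex_rip_max_cliques:
  assumes sym: "symp E" and chordal: "\<And>c m. 4 \<le> m \<Longrightarrow> \<not> chordless_cycle E c m"
    and "finite V"
  shows "\<exists>Ds. distinct Ds \<and> set Ds = max_cliques_in E V \<and> rip Ds"
  using \<open>finite V\<close>
proof (induction V rule: finite_psubset_induct)
  case (psubset V)
  show ?case
  proof (cases "V = {}")
    case True
    \<comment> \<open>On no vertices the empty set is itself a maximal clique, so the list is not
      empty.\<close>
    then have "max_cliques_in E V = {{}}" by (auto simp: max_cliques_in_def clique_in_def)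
    then show ?thesis by (intro exI[of _ "[{}]"]) simp
  next
    case False
    then obtain v where v: "v \<in> V"
      "\<forall>x\<in>V. \<forall>y\<in>V. E v x \<longrightarrow> E v y \<longrightarrow> x \<noteq> y \<longrightarrow> x \<noteq> v \<longrightarrow> y \<noteq> v \<longrightarrow> E x y"
      using ex_simplicial_vertex[OF sym chordal psubset.hyps] by blast
    define N where "N = {u \<in> V - {v}. E v u}"
    have N: "clique_in E (V - {v}) N" using v by (auto simp: clique_in_def N_def)
    have mc: "max_cliques_in E V = insert (insert v N) (max_cliques_in E (V - {v}) - {N})"
      using max_cliques_in_remove_simplicial[OF sym v(1) N_def N] .
    obtain Ds where Ds: "distinct Ds" "set Ds = max_cliques_in E (V - {v})" "rip Ds"
      using psubset.IH[of "V - {v}"] v(1) by blast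
    have vD: "v \<notin> \<Union> (set Ds)" using Ds(2) by (auto simp: max_cliques_in_def clique_in_def)
    show ?thesis
    proof (cases "N \<in> set Ds")
      case True
      let ?f = "\<lambda>X. if X = N then insert v N else X"
      have "inj_on ?f (set Ds)" using vD by (auto simp: inj_on_def)
      moreover have "?f ` set Ds = max_cliques_in E V" using True mc Ds(2) by auto
      ultimately show ?thesis
        using rip_enlarge[OF Ds(3,1) vD, of N] Ds(1)
        by (intro exI[of _ "map ?f Ds"]) (auto simp: distinct_map)
    next
      case False
      obtain D where "D \<in> set Ds" "N \<subseteq> D"
        using clique_in_extend[OF _ N] psubset.hyps Ds(2) by auto
      \<comment> \<open>As \<open>v\<close> is new, \<open>insert v N\<close> meets the other
        cliques only inside \<open>N\<close>, hence inside \<open>D\<close>.\<close>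
      then have "rip (insert v N # Ds)" using Ds(3) vD by auto
      moreover have "set (insert v N # Ds) = max_cliques_in E V" using mc Ds(2) False by simp
      moreover have "distinct (insert v N # Ds)" using vD Ds(1) by auto
      ultimately show ?thesis by blast
    qed
  qed
qed

section \<open>Perfect sequences of a chordal graph\<close>

lemma (in sym_digraph) symmetric_adj: "u \<rightarrow>\<^bsub>G\<^esub> v \<Longrightarrow> v \<rightarrow>\<^bsub>G\<^esub> u"
  using arcs_ends_symmetric[OF sym_arcs] .

text \<open>Choosing an arc for each step turns the vertex sequence into a library cycle; its chord
  joins two of the \<open>c i\<close> that are neither consecutive nor the closing pair.\<close>

lemma (in graph) chordal_no_chordless_cycle:
  assumes "chordal G" "4 \<le> m"
  shows "\<not> chordless_cycle (\<lambda>u v. u \<rightarrow>\<^bsub>G\<^esub> v) c m"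
proof
  assume "chordless_cycle (\<lambda>u v. u \<rightarrow>\<^bsub>G\<^esub> v) c m"
  then have c: "c m = c 0" "inj_on c {..<m}" "\<And>i. i < m \<Longrightarrow> c i \<rightarrow>\<^bsub>G\<^esub> c (Suc i)"
    and ch: "\<And>i j. i < j \<Longrightarrow> j < m \<Longrightarrow> c i \<rightarrow>\<^bsub>G\<^esub> c j \<Longrightarrow> j = Suc i \<or> i = 0 \<and> Suc j = m"
    by (auto simp: chordless_cycle_def)
  have "\<forall>i. \<exists>e. i < m \<longrightarrow> e \<in> arcs G \<and> tail G e = c i \<and> head G e = c (Suc i)"
    using c(3) by (fastforce simp: arcs_ends_conv)
  then obtain a where a: "\<And>i. i < m \<Longrightarrow> a i \<in> arcs G \<and> tail G (a i) = c i \<and> head G (a i) = c (Suc i)"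
    by metis
  define p where "p = map a [0..<m]"
  have "cas (c 0) (map a [0..<k]) (c k)" if "k \<le> m" for k
    using that by (induction k) (auto simp: cas_append_iff awlast_if_cas a)
  then have cas: "cas (c 0) p (c m)" by (simp add: p_def)
  have "map (tail G \<circ> a) [0..<m] = map c [0..<m]" using a by simp
  moreover have "head G (last p) = c m" using a[of "m - 1"] assms(2) by (simp add: p_def last_map)
  ultimately have av: "awalk_verts (c 0) p = map c [0..<Suc m]"
    using assms(2) by (simp add: awalk_verts_conv p_def)
  \<comment> \<open>A library cycle requires distinctness of the vertices after the first, that is
    on indices 1 to \<open>m\<close>; reduction modulo \<open>m\<close> leads back to injectivity on
    \<open>{..<m}\<close>.\<close>
  have "distinct (map c [Suc 0..<Suc m])"
  proof -
    have "inj_on c (set [Suc 0..<Suc m])"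
    proof (rule inj_onI)
      fix i j assume "i \<in> set [Suc 0..<Suc m]" "j \<in> set [Suc 0..<Suc m]" "c i = c j"
      moreover have "c (k mod m) = c k" if "k \<le> m" for k
        using that c(1) by (cases "k = m") auto
      ultimately have "i mod m = j mod m"
        using assms(2) by (intro inj_onD[OF c(2)]) (simp_all del: upt_Suc)
      with \<open>i \<in> _\<close> \<open>j \<in> _\<close> show "i = j"
        by (cases "i = m"; cases "j = m") auto
    qed
    then show ?thesis by (simp add: distinct_map del: upt_Suc)
  qed
  moreover have "tl (map c [0..<Suc m]) = map c [Suc 0..<Suc m]"
    by (metis map_tl tl_upt)
  moreover have "c 0 \<in> verts G" using c(3)[of 0] assms(2) adj_in_verts(1) by simp
  ultimately have "cycle p"
    using cas av a c(1) assms(2) unfolding cycle_def awalk_def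
    by (intro exI[of _ "c 0"]) (auto simp: p_def simp del: upt_Suc)
  moreover have "4 \<le> length p" using assms(2) by (simp add: p_def)
  ultimately obtain e where e: "is_chord G p e" using assms(1) unfolding chordal_def by blast
  have T: "tail G ` set p = c ` {..<m}" using a by (force simp: p_def image_iff)
  obtain i j where ij: "i < m" "j < m" "tail G e = c i" "head G e = c j" "e \<in> arcs G"
    using e T unfolding is_chord_def by auto
  have nch: "{c k, c (Suc k)} \<noteq> {c i, c j}" if "k < m" for k
  proof -
    have "a k \<in> set p" using that by (simp add: p_def)
    then have "{tail G (a k), head G (a k)} \<noteq> {tail G e, head G e}"
      using e unfolding is_chord_def by blast
    then show ?thesis using a[OF that] ij(3,4) by simp
  qed
  have "c i \<rightarrow>\<^bsub>G\<^esub> c j" using ij by (metis in_arcs_imp_in_arcs_ends)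
  then have E: "c i \<rightarrow>\<^bsub>G\<^esub> c j" "c j \<rightarrow>\<^bsub>G\<^esub> c i" using symmetric_adj by blast+
  have "i \<noteq> j" using ij no_loops by metis
  then consider "i < j" | "j < i" by linarith
  then show False
  proof cases
    case 1
    then have "j = Suc i \<or> i = 0 \<and> Suc j = m" using ch E ij by blast
    then show False using nch[of i] nch[of j] ij c(1) by (auto simp: insert_commute)
  next
    case 2
    then have "i = Suc j \<or> j = 0 \<and> Suc i = m" using ch E ij by blast
    then show False using nch[of i] nch[of j] ij c(1) by (auto simp: insert_commute)
  qed
qed

lemma maximal_cliques_eq: "maximal_cliques G = max_cliques_in (\<lambda>u v. u \<rightarrow>\<^bsub>G\<^esub> v) (verts G)"
  by (simp add: maximal_cliques_def max_cliques_in_def clique_def clique_in_def)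

context graph
begin

section \<open>Simplicial vertices and maximal cliques\<close>

lemma simplicial_iff_unique_max_clique:
  assumes C: "C \<in> maximal_cliques G" "v \<in> C"
  shows "simplicial G v \<longleftrightarrow> (\<forall>D\<in>maximal_cliques G. v \<in> D \<longrightarrow> D = C)"
proof
  have vV: "v \<in> verts G" using C by (auto simp: maximal_cliques_def clique_def)
  {
    assume "simplicial G v"
    then have cl: "clique G (insert v (neighbors G v))"
      using vV symmetric_adj unfolding simplicial_def clique_def neighbors_def by blast
    have "D = insert v (neighbors G v)" if "D \<in> maximal_cliques G" "v \<in> D" for D
    proof -
      have "D \<subseteq> insert v (neighbors G v)"
        using that by (auto simp: maximal_cliques_def clique_def neighbors_def)
      then show ?thesis using that cl by (auto simp: maximal_cliques_def)
    qed
    then show "\<forall>D\<in>maximal_cliques G. v \<in> D \<longrightarrow> D = C" using C by blast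
  }
  assume uniq: "\<forall>D\<in>maximal_cliques G. v \<in> D \<longrightarrow> D = C"
  \<comment> \<open>Each edge at \<open>v\<close> extends to a maximal clique, which by uniqueness
    is \<open>C\<close>.\<close>
  have "neighbors G v \<subseteq> C"
  proof
    fix u assume u: "u \<in> neighbors G v"
    then have "clique_in (\<lambda>u v. u \<rightarrow>\<^bsub>G\<^esub> v) (verts G) {u, v}"
      using vV symmetric_adj[of v u] by (simp add: clique_in_def neighbors_def)
    then obtain D where "D \<in> maximal_cliques G" "{u, v} \<subseteq> D"
      using clique_in_extend[OF finite_verts] by (metis maximal_cliques_eq)
    then show "u \<in> C" using uniq by blast
  qed
  then show "simplicial G v"
    using C vV unfolding simplicial_def maximal_cliques_def clique_def by blast
qed

text \<open>The other maximal cliques avoid \<open>Simp G C\<close> and survive. What remains of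
  \<open>C\<close> is \<open>Sep G C\<close>, which is contained in \<open>C'\<close>, so no new
  maximal clique arises.\<close>

lemma max_cliques_remove_Simp:
  assumes "simply_separated G C"
  shows "max_cliques_in (\<lambda>u v. u \<rightarrow>\<^bsub>G\<^esub> v) (verts G - Simp G C) = maximal_cliques G - {C}"
proof -
  let ?E = "\<lambda>u v. u \<rightarrow>\<^bsub>G\<^esub> v"
  obtain C' where C: "C \<in> maximal_cliques G" "Simp G C \<noteq> {}" "C' \<in> maximal_cliques G" "Sep G C = C \<inter> C'"
    using assms by (auto simp: simply_separated_def)
  have disj: "D \<inter> Simp G C = {}" if "D \<in> maximal_cliques G" "D \<noteq> C" for D
    using simplicial_iff_unique_max_clique[OF C(1)] that by (auto simp: Simp_def)
  have C': "C' \<noteq> C" using C by (auto simp: Sep_def Simp_def)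
  have iff: "clique_in ?E (verts G - Simp G C) D \<longleftrightarrow> clique_in ?E (verts G) D \<and> D \<inter> Simp G C = {}" for D
    by (auto simp: clique_in_def)
  have ext: "\<exists>M\<in>maximal_cliques G - {C}. D \<subseteq> M" if "clique_in ?E (verts G - Simp G C) D" for D
  proof -
    have D: "clique_in ?E (verts G) D" "D \<inter> Simp G C = {}" using that iff by auto
    obtain M where M: "M \<in> maximal_cliques G" "D \<subseteq> M"
      using clique_in_extend[OF finite_verts D(1)] by (metis maximal_cliques_eq)
    show ?thesis
    proof (cases "M = C")
      case True
      then have "D \<subseteq> C'" using M D C(4) by (auto simp: Sep_def)
      then show ?thesis using C C' by blast
    qed (use M in blast)
  qed
  show ?thesis
  proof (intro equalityI subsetI)
    fix X assume X: "X \<in> max_cliques_in ?E (verts G - Simp G C)"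
    then obtain M where M: "M \<in> maximal_cliques G - {C}" "X \<subseteq> M" using ext unfolding max_cliques_in_def by blast
    then have "clique_in ?E (verts G - Simp G C) M"
      using disj iff by (auto simp: maximal_cliques_eq max_cliques_in_def)
    then show "X \<in> maximal_cliques G - {C}" using X M by (auto simp: max_cliques_in_def)
  next
    fix X assume "X \<in> maximal_cliques G - {C}"
    then show "X \<in> max_cliques_in ?E (verts G - Simp G C)"
      using disj iff by (auto simp: maximal_cliques_eq max_cliques_in_def)
  qed
qed

section \<open>Simple separation and the last clique\<close>

lemma perfect_sequence_last_imp_simply_separated:
  assumes Cs: "bij_betw Cs {1..K} (maximal_cliques G)" and "2 \<le> K"
    and p: "perfect_sequence G K Cs p"
  shows "simply_separated G (Cs (p K))"
proof -
  define C where "C = Cs (p K)"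
  have perm: "p permutes {1..K}" using p by (simp add: perfect_sequence_def)
  then have bij: "bij_betw (\<lambda>i. Cs (p i)) {1..K} (maximal_cliques G)"
    using bij_betw_trans[OF permutes_imp_bij Cs] by (simp add: o_def)
  then have mc: "maximal_cliques G = (\<lambda>i. Cs (p i)) ` {1..K}" by (simp add: bij_betw_def)
  have C: "C \<in> maximal_cliques G" using mc \<open>2 \<le> K\<close> by (auto simp: C_def)
  have ne: "Cs (p i) \<noteq> C" if "i \<in> {1..<K}" for i
    using inj_onD[OF bij_betw_imp_inj_on[OF bij], of i K] that by (auto simp: C_def)
  have others: "maximal_cliques G - {C} = (\<lambda>i. Cs (p i)) ` {1..<K}"
  proof -
    have "{1..K} = insert K {1..<K}" using \<open>2 \<le> K\<close> by auto
    then show ?thesis using ne unfolding mc C_def by auto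
  qed
  define S where "S = perfect_sep Cs p K"
  \<comment> \<open>For the last clique the separator does not depend on the order: it collects the
    vertices of \<open>C\<close> lying in another maximal clique.\<close>
  have S: "S = \<Union> (maximal_cliques G - {C}) \<inter> C"
    unfolding others by (simp add: S_def perfect_sep_def C_def)
  obtain k' where "k' \<in> {1..<K}" "S \<subset> Cs (p k')"
    using p \<open>2 \<le> K\<close> unfolding perfect_sequence_def S_def
    by (metis atLeastAtMost_iff order_refl)
  then obtain C' where C': "C' \<in> maximal_cliques G" "C' \<noteq> C" "S \<subseteq> C'" using others by blast
  \<comment> \<open>This makes \<open>C - S\<close>, and hence \<open>Simp G C\<close>,
    nonempty.\<close>
  have "\<not> C \<subseteq> C'" using max_cliques_in_antichain C C' by (metis maximal_cliques_eq)
  have "Simp G C = C - S"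
    using simplicial_iff_unique_max_clique[OF C] by (auto simp: Simp_def S)
  moreover have "S = C \<inter> C'" using C' S by blast
  ultimately show ?thesis
    unfolding C_def[symmetric] simply_separated_def
    using C C' \<open>\<not> C \<subseteq> C'\<close> by (auto simp: Sep_def)
qed

text \<open>The list is read backwards, place \<open>k\<close> being position \<open>K - k\<close>.
  Proper containment of the separators comes from the antichain property of maximal cliques.\<close>

lemma perfect_sequence_of_rip:
  assumes Cs: "bij_betw Cs {1..K} (maximal_cliques G)"
    and Ds: "distinct Ds" "set Ds = maximal_cliques G" "rip Ds"
  shows "\<exists>p. perfect_sequence G K Cs p \<and> (\<forall>k\<in>{1..K}. Cs (p k) = Ds ! (K - k))"
proof -
  have len: "length Ds = K"
    using Ds Cs by (metis bij_betw_same_card card_atLeastAtMost diff_Suc_1 distinct_card)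
  \<comment> \<open>The identity outside \<open>{1..K}\<close> is what \<open>permutes\<close>
    demands.\<close>
  define p where "p k = (if k \<in> {1..K} then inv_into {1..K} Cs (Ds ! (K - k)) else k)" for k
  have "bij_betw (\<lambda>k. Ds ! (K - k)) {1..K} (maximal_cliques G)"
  proof -
    have "bij_betw (\<lambda>k. K - k) {1..K} {..<K}"
      by (rule bij_betw_byWitness[where f' = "\<lambda>k. K - k"]) auto
    then show ?thesis
      using bij_betw_trans[OF _ bij_betw_nth[OF Ds(1)]] len Ds(2) by (fastforce simp: o_def)
  qed
  then have "bij_betw (\<lambda>k. inv_into {1..K} Cs (Ds ! (K - k))) {1..K} {1..K}"
    using bij_betw_trans[OF _ bij_betw_inv_into[OF Cs]] by (fastforce simp: o_def)
  then have "bij_betw p {1..K} {1..K}" by (subst bij_betw_cong[where g = "\<lambda>k. inv_into {1..K} Cs (Ds ! (K - k))"]) (auto simp: p_def)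
  then have perm: "p permutes {1..K}" by (rule bij_imp_permutes) (auto simp: p_def)
  have Cp: "Cs (p k) = Ds ! (K - k)" if "k \<in> {1..K}" for k
  proof -
    have "Ds ! (K - k) \<in> Cs ` {1..K}" using that len Ds(2) Cs by (auto simp: bij_betw_def)
    then show ?thesis using that by (simp add: p_def f_inv_into_f)
  qed
  have mem: "Cs (p k) \<in> maximal_cliques G" if "k \<in> {1..K}" for k
    using Cp[OF that] that len Ds(2) by auto
  have "perfect_sequence G K Cs p"
    unfolding perfect_sequence_def
  proof (intro conjI ballI perm)
    fix k assume k: "k \<in> {2..K}"
    have "clique G (Cs (p k))" using mem[of k] k by (simp add: maximal_cliques_def)
    then show "clique G (perfect_sep Cs p k)"
      unfolding clique_def perfect_sep_def by blast
    have "Cs (p i) \<in> set (drop (Suc (K - k)) Ds)" if "i \<in> {1..<k}" for i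
    proof -
      have "drop (Suc (K - k)) Ds ! (k - i - 1) = Ds ! (K - i)"
      proof -
        have "Suc (K - k) + (k - i - 1) = K - i" using that k by auto
        moreover have "Suc (K - k) \<le> length Ds" using k len by auto
        ultimately show ?thesis by (metis nth_drop)
      qed
      moreover have "k - i - 1 < length (drop (Suc (K - k)) Ds)" using that k len by auto
      ultimately show ?thesis using Cp[of i] that k by (metis atLeastAtMost_iff atLeastLessThan_iff
            less_imp_le nth_mem order_trans)
    qed
    moreover obtain l where l: "K - k < l" "l < K"
      "Ds ! (K - k) \<inter> \<Union> (set (drop (Suc (K - k)) Ds)) \<subseteq> Ds ! l"
    proof -
      have "Suc (K - k) < length Ds" using k len by auto
      then show ?thesis using rip_nth[OF Ds(3)] that len by blast
    qed
    moreover have l': "K - l \<in> {1..<k}" "Cs (p (K - l)) = Ds ! l"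
      using l k Cp[of "K - l"] by auto
    moreover have Ck: "Cs (p k) = Ds ! (K - k)" using Cp[of k] k by simp
    ultimately have sub: "perfect_sep Cs p k \<subseteq> Cs (p (K - l))"
      unfolding perfect_sep_def by blast
    have "Ds ! l \<noteq> Ds ! (K - k)" using l k Ds(1) len by (simp add: nth_eq_iff_index_eq)
    moreover have "Ds ! l \<in> maximal_cliques G" "Ds ! (K - k) \<in> maximal_cliques G"
      using l k len Ds(2) by auto
    ultimately have "\<not> Ds ! l \<subseteq> Ds ! (K - k)"
      using max_cliques_in_antichain by (metis maximal_cliques_eq)
    \<comment> \<open>Equality would put the clique \<open>Ds ! l\<close> inside
      \<open>Ds ! (K - k)\<close>.\<close>
    then have "perfect_sep Cs p k \<noteq> Cs (p (K - l))"
      using l'(2) Ck unfolding perfect_sep_def by blast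
    then show "\<exists>k'\<in>{1..<k}. perfect_sep Cs p k \<subset> Cs (p k')" using sub l' by blast
  qed
  then show ?thesis using Cp by blast
qed

end

theorem theorem3p3:
  fixes G :: "('a, 'b) pre_digraph" and Cs :: "nat \<Rightarrow> 'a set" and K :: nat and C :: "'a set"
  assumes "graph G"
    and "Digraph_Component.connected G"
    and "chordal G"
    and "bij_betw Cs {1..K} (maximal_cliques G)"
    and "2 \<le> K"
    and "C \<in> maximal_cliques G"
  shows "simply_separated G C \<longleftrightarrow> (\<exists>p. perfect_sequence G K Cs p \<and> Cs (p K) = C)"
proof
  interpret graph G by fact
  let ?E = "\<lambda>u v. u \<rightarrow>\<^bsub>G\<^esub> v"
  {
    assume ss: "simply_separated G C"
    then obtain C' where C': "C' \<in> maximal_cliques G" "Simp G C \<noteq> {}" "Sep G C = C \<inter> C'"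
      by (auto simp: simply_separated_def)
    have ne: "C' \<noteq> C" using C' by (auto simp: Sep_def Simp_def)
    have "symp ?E" by (rule sympI) (rule symmetric_adj)
    then obtain Ds where Ds: "distinct Ds" "set Ds = maximal_cliques G - {C}" "rip Ds"
      using ex_rip_max_cliques[of ?E "verts G - Simp G C"] max_cliques_remove_Simp[OF ss]
        chordal_no_chordless_cycle[OF assms(3)] by auto
    \<comment> \<open>A vertex shared with another maximal clique is not simplicial; as
      \<open>Sep G C = C \<inter> C'\<close>, the clique \<open>C'\<close> witnesses the running
      intersection property for \<open>C\<close>.\<close>
    have "C \<inter> \<Union> (set Ds) \<subseteq> Sep G C"
      using simplicial_iff_unique_max_clique[OF assms(6)] by (auto simp: Ds(2) Sep_def Simp_def)
    moreover have "C' \<in> set Ds" using Ds C' ne by simp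
    ultimately have "rip (C # Ds)" using Ds(3) C'(3) unfolding rip.simps by blast
    then obtain p where "perfect_sequence G K Cs p" "\<forall>k\<in>{1..K}. Cs (p k) = (C # Ds) ! (K - k)"
      using perfect_sequence_of_rip[OF assms(4), of "C # Ds"] Ds assms(6) by auto
    then show "\<exists>p. perfect_sequence G K Cs p \<and> Cs (p K) = C"
      using assms(5) by (intro exI[of _ p]) auto
  }
  show "simply_separated G C" if "\<exists>p. perfect_sequence G K Cs p \<and> Cs (p K) = C"
    using that perfect_sequence_last_imp_simply_separated[OF assms(4,5)] by blast
qed

end
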